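(* Let $n\ge2$ be an integer and let $\widetilde f(x)=p\,\delta(x)+(1-p)f(x)$ be a generalized density, with $f$ a probability density on $\mathbb{R}$. If $p\in(2^{-1/(n-1)},1)$, then $\widetilde f^{\ast n}\in\mathcal{S}$ implies $\widetilde f\in\mathcal{S}$.
   Context: $\delta$ is the Dirac delta at $0$; the generalized density $\widetilde f$ represents the measure $p\delta_0(dx)+(1-p)f(x)dx$, and for $x\ne0$ its value is $(1-p)f(x)$. Convolution powers are convolutions of measures: $\widetilde f^{\ast n}=\sum_{k=0}^n\binom nk(1-p)^kp^{n-k}f^{\ast k}$ with $f^{\ast0}=\delta$. The tail definitions below are applied to generalized densities through their values at $x\neq0$. $\alpha(x)\sim\beta(x)$ means $\alpha(x)/\beta(x)\to1$ as $x\to\infty$. A (generalized) density $h$ is long-tailed, $h\in\mathcal{L}$, if there is $x_0>0$ with $h(x)>0$ for $x\ge x_0$ and, for each fixed $y>0$, $h(x+y)\sim h(x)$. It is subexponential, $h\in\mathcal{S}$, if $h\in\mathcal{L}$ and $h^{\ast2}(x)\sim2h(x)$. *)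

theory Defs
  imports "HOL-Probability.Probability"
begin

text \<open>
  \<open>GDens a f\<close> stands for the generalized density \<open>a \<delta>(x) + f(x)\<close>, i.e. for the measure
  \<open>a \<delta>\<^sub>0(dx) + f(x) dx\<close>.  Tail properties of (generalized) densities are pointwise, so a fixed
  function \<open>f\<close> is carried along instead of the measure.  Its values are in \<open>ennreal\<close> because the
  convolution integral of two densities can be infinite at some points.  An ordinary density has
  atom \<open>0\<close>.
\<close>

datatype gdens = GDens (atom: ennreal) (dens: "real \<Rightarrow> ennreal")

definition gd_delta :: gdens where
  "gd_delta = GDens 1 (\<lambda>x. 0)"

text \<open>
  The convolution of \<open>a \<delta> + f\<close> and \<open>b \<delta> + g\<close> is \<open>a b \<delta> + (a g + b f + f * g)\<close>;
  lemma \<open>represents_conv\<close> below relates it to the convolution of measures.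
\<close>

definition gd_conv :: "gdens \<Rightarrow> gdens \<Rightarrow> gdens" where
  "gd_conv h k = GDens (atom h * atom k)
     (\<lambda>x. atom h * dens k x + atom k * dens h x + (\<integral>\<^sup>+y. dens h (x - y) * dens k y \<partial>lborel))"

primrec gd_pow :: "gdens \<Rightarrow> nat \<Rightarrow> gdens" where
  "gd_pow h 0 = gd_delta"
| "gd_pow h (Suc n) = gd_conv (gd_pow h n) h"

text \<open>
  In \<open>ennreal\<close> we have \<open>\<infinity> / \<infinity> = 0\<close>, \<open>0 / 0 = 0\<close>, and \<open>c / 0 = \<infinity>\<close>, \<open>c / \<infinity> = 0\<close> otherwise, so
  a ratio tending to \<open>1\<close> forces both functions to be finite and nonzero for all large arguments.
\<close>

definition tail_equiv :: "(real \<Rightarrow> ennreal) \<Rightarrow> (real \<Rightarrow> ennreal) \<Rightarrow> bool" where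
  "tail_equiv \<alpha> \<beta> \<longleftrightarrow> ((\<lambda>x. \<alpha> x / \<beta> x) \<longlongrightarrow> 1) at_top"

definition long_tailed :: "gdens \<Rightarrow> bool" where
  "long_tailed h \<longleftrightarrow>
     (\<exists>x0>0. \<forall>x\<ge>x0. dens h x > 0) \<and>
     (\<forall>y>0. tail_equiv (\<lambda>x. dens h (x + y)) (dens h))"

definition subexponential :: "gdens \<Rightarrow> bool" where
  "subexponential h \<longleftrightarrow>
     long_tailed h \<and> tail_equiv (dens (gd_pow h 2)) (\<lambda>x. 2 * dens h x)"

definition prob_density :: "(real \<Rightarrow> real) \<Rightarrow> bool" where
  "prob_density f \<longleftrightarrow>
     f \<in> borel_measurable borel \<and> (\<forall>x. f x \<ge> 0) \<and> (\<integral>\<^sup>+x. ennreal (f x) \<partial>lborel) = 1"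

text \<open>The generalized density \<open>p \<delta>(x) + (1 - p) f(x)\<close>, for \<open>0 \<le> p \<le> 1\<close>.\<close>

definition gd_mix :: "real \<Rightarrow> (real \<Rightarrow> real) \<Rightarrow> gdens" where
  "gd_mix p f = GDens (ennreal p) (\<lambda>x. ennreal ((1 - p) * f x))"


section \<open>Agreement with the convolution of measures\<close>

definition represents :: "gdens \<Rightarrow> real measure \<Rightarrow> bool" where
  "represents h M \<longleftrightarrow> sets M = sets borel \<and>
     (\<forall>A\<in>sets borel. emeasure M A =
        atom h * indicator A 0 + (\<integral>\<^sup>+x. dens h x * indicator A x \<partial>lborel))"

lemma nn_integral_represents:
  assumes M: "represents h M" and h[measurable]: "dens h \<in> borel_measurable borel"
    and f: "f \<in> borel_measurable borel"
  shows "(\<integral>\<^sup>+x. f x \<partial>M) = atom h * f 0 + (\<integral>\<^sup>+x. dens h x * f x \<partial>lborel)"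
proof -
  have s[measurable_cong]: "sets M = sets borel"
    and e: "\<And>A. A \<in> sets borel \<Longrightarrow> emeasure M A =
        atom h * indicator A 0 + (\<integral>\<^sup>+x. dens h x * indicator A x \<partial>lborel)"
    using M by (auto simp: represents_def)
  show ?thesis
    using f
  proof (induct rule: borel_measurable_induct)
    case (cong f g)
    then show ?case by (simp cong: nn_integral_cong)
  next
    case (set A)
    then show ?case by (simp add: e s)
  next
    case (mult u c)
    have [measurable]: "u \<in> borel_measurable borel" by fact
    have "(\<integral>\<^sup>+x. c * u x \<partial>M) = c * (\<integral>\<^sup>+x. u x \<partial>M)"
      by (rule nn_integral_cmult) measurable
    moreover have "(\<integral>\<^sup>+x. dens h x * (c * u x) \<partial>lborel) = c * (\<integral>\<^sup>+x. dens h x * u x \<partial>lborel)"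
      by (subst nn_integral_cmult[symmetric]) (auto simp: ac_simps)
    ultimately show ?case by (simp add: mult distrib_left ac_simps)
  next
    case (add u v)
    have [measurable]: "u \<in> borel_measurable borel" "v \<in> borel_measurable borel" by fact+
    have "(\<integral>\<^sup>+x. v x + u x \<partial>M) = (\<integral>\<^sup>+x. v x \<partial>M) + (\<integral>\<^sup>+x. u x \<partial>M)"
      by (rule nn_integral_add) measurable
    moreover have "(\<integral>\<^sup>+x. dens h x * (v x + u x) \<partial>lborel) =
        (\<integral>\<^sup>+x. dens h x * v x \<partial>lborel) + (\<integral>\<^sup>+x. dens h x * u x \<partial>lborel)"
      by (subst nn_integral_add[symmetric]) (auto simp: distrib_left)
    ultimately show ?case by (simp add: add distrib_left ac_simps)
  next
    case (seq U)
    have [measurable]: "\<And>i. U i \<in> borel_measurable borel" by fact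
    have inc: "\<And>x. incseq (\<lambda>i. U i x)" using \<open>incseq U\<close> by (auto simp: incseq_def le_fun_def)
    have "(\<integral>\<^sup>+x. (SUP i. U i) x \<partial>M) = (SUP i. \<integral>\<^sup>+x. U i x \<partial>M)"
      by (simp add: SUP_apply image_comp) (rule nn_integral_monotone_convergence_SUP[OF \<open>incseq U\<close>], measurable)
    moreover have "(\<integral>\<^sup>+x. dens h x * (SUP i. U i) x \<partial>lborel) =
        (SUP i. \<integral>\<^sup>+x. dens h x * U i x \<partial>lborel)"
      using \<open>incseq U\<close>
      by (subst nn_integral_monotone_convergence_SUP[symmetric])
         (auto simp: SUP_apply image_comp SUP_mult_left_ennreal incseq_def le_fun_def intro!: mult_left_mono)
    moreover have "atom h * (SUP i. U i) 0 = (SUP i. atom h * U i 0)"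
      by (simp add: SUP_apply image_comp SUP_mult_left_ennreal)
    moreover have "(SUP i. atom h * U i 0 + (\<integral>\<^sup>+x. dens h x * U i x \<partial>lborel)) =
        (SUP i. atom h * U i 0) + (SUP i. \<integral>\<^sup>+x. dens h x * U i x \<partial>lborel)"
      using inc
      by (intro ennreal_SUP_add)
         (auto simp: incseq_def intro!: mult_left_mono nn_integral_mono)
    ultimately show ?case by (simp add: seq)
  qed
qed

lemma represents_delta: "represents gd_delta (return borel 0)"
  by (simp add: represents_def gd_delta_def)

lemma represents_conv:
  assumes M: "represents h M" "finite_measure M" and h[measurable]: "dens h \<in> borel_measurable borel"
    and N: "represents k N" "finite_measure N" and k[measurable]: "dens k \<in> borel_measurable borel"
  shows "represents (gd_conv h k) (M \<star> N)"
  unfolding represents_def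
proof safe
  fix A :: "real set" assume A[measurable]: "A \<in> sets borel"
  have s[measurable_cong]: "sets M = sets borel" "sets N = sets borel"
    using M N by (auto simp: represents_def)
  have inner: "(\<integral>\<^sup>+y. indicator A (x + y) \<partial>N) =
      atom k * indicator A x + (\<integral>\<^sup>+y. dens k y * indicator A (x + y) \<partial>lborel)" for x
    by (subst nn_integral_represents[OF N(1) k]) auto
  have shift: "(\<integral>\<^sup>+x. dens h x * (\<integral>\<^sup>+y. dens k y * indicator A (x + y) \<partial>lborel) \<partial>lborel) =
      (\<integral>\<^sup>+x. (\<integral>\<^sup>+y. dens h (x - y) * dens k y \<partial>lborel) * indicator A x \<partial>lborel)" (is "?l = ?r")
  proof -
    have "?l = (\<integral>\<^sup>+x. (\<integral>\<^sup>+y. dens h x * (dens k y * indicator A (x + y)) \<partial>lborel) \<partial>lborel)"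
      by (intro nn_integral_cong, subst nn_integral_cmult) auto
    also have "\<dots> = (\<integral>\<^sup>+y. (\<integral>\<^sup>+x. dens h x * (dens k y * indicator A (x + y)) \<partial>lborel) \<partial>lborel)"
      by (intro lborel_pair.Fubini') simp
    also have "\<dots> = (\<integral>\<^sup>+y. (\<integral>\<^sup>+x. dens h (x - y) * dens k y * indicator A x \<partial>lborel) \<partial>lborel)"
    proof (rule nn_integral_cong)
      fix y :: real
      show "(\<integral>\<^sup>+x. dens h x * (dens k y * indicator A (x + y)) \<partial>lborel) =
          (\<integral>\<^sup>+x. dens h (x - y) * dens k y * indicator A x \<partial>lborel)"
        by (subst nn_integral_real_affine[where c=1 and t="-y"])
           (auto simp add: one_ennreal_def[symmetric] ac_simps)
    qed
    also have "\<dots> = (\<integral>\<^sup>+x. (\<integral>\<^sup>+y. dens h (x - y) * dens k y * indicator A x \<partial>lborel) \<partial>lborel)"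
      by (intro lborel_pair.Fubini') simp
    also have "\<dots> = ?r"
      by (intro nn_integral_cong, subst nn_integral_multc) auto
    finally show ?thesis .
  qed
  have "emeasure (M \<star> N) A = (\<integral>\<^sup>+x. \<integral>\<^sup>+y. indicator A (x + y) \<partial>N \<partial>M)"
    using M N s by (intro convolution_emeasure') auto
  also have "\<dots> = (\<integral>\<^sup>+x. atom k * indicator A x +
      (\<integral>\<^sup>+y. dens k y * indicator A (x + y) \<partial>lborel) \<partial>M)"
    by (simp add: inner)
  also have "\<dots> = atom h * (atom k * indicator A 0 + (\<integral>\<^sup>+y. dens k y * indicator A y \<partial>lborel)) +
      (\<integral>\<^sup>+x. dens h x * (atom k * indicator A x +
        (\<integral>\<^sup>+y. dens k y * indicator A (x + y) \<partial>lborel)) \<partial>lborel)"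
    by (subst nn_integral_represents[OF M(1) h]) auto
  also have "(\<integral>\<^sup>+x. dens h x * (atom k * indicator A x +
        (\<integral>\<^sup>+y. dens k y * indicator A (x + y) \<partial>lborel)) \<partial>lborel) =
      (\<integral>\<^sup>+x. atom k * dens h x * indicator A x \<partial>lborel) +
      (\<integral>\<^sup>+x. dens h x * (\<integral>\<^sup>+y. dens k y * indicator A (x + y) \<partial>lborel) \<partial>lborel)"
    by (subst nn_integral_add[symmetric]) (auto simp: distrib_left ac_simps)
  also note shift
  also have "atom h * (atom k * indicator A 0 + (\<integral>\<^sup>+y. dens k y * indicator A y \<partial>lborel)) =
      atom h * atom k * indicator A 0 + (\<integral>\<^sup>+x. atom h * dens k x * indicator A x \<partial>lborel)"
    by (simp add: distrib_left mult.assoc nn_integral_cmult)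
  finally have 1: "emeasure (M \<star> N) A = atom h * atom k * indicator A 0 +
      ((\<integral>\<^sup>+x. atom h * dens k x * indicator A x \<partial>lborel) +
       (\<integral>\<^sup>+x. atom k * dens h x * indicator A x \<partial>lborel) +
       (\<integral>\<^sup>+x. (\<integral>\<^sup>+y. dens h (x - y) * dens k y \<partial>lborel) * indicator A x \<partial>lborel))"
    by (simp add: add.assoc)
  have "(\<integral>\<^sup>+x. dens (gd_conv h k) x * indicator A x \<partial>lborel) =
      (\<integral>\<^sup>+x. (atom h * dens k x * indicator A x + atom k * dens h x * indicator A x) +
        (\<integral>\<^sup>+y. dens h (x - y) * dens k y \<partial>lborel) * indicator A x \<partial>lborel)"
    by (simp add: gd_conv_def distrib_right)
  also have "\<dots> = (\<integral>\<^sup>+x. atom h * dens k x * indicator A x \<partial>lborel) +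
       (\<integral>\<^sup>+x. atom k * dens h x * indicator A x \<partial>lborel) +
       (\<integral>\<^sup>+x. (\<integral>\<^sup>+y. dens h (x - y) * dens k y \<partial>lborel) * indicator A x \<partial>lborel)"
    by (simp add: nn_integral_add)
  finally show "emeasure (M \<star> N) A = atom (gd_conv h k) * indicator A 0 +
      (\<integral>\<^sup>+x. dens (gd_conv h k) x * indicator A x \<partial>lborel)"
    using 1 by (simp add: gd_conv_def)
qed simp_all


section \<open>The binomial formula for convolution powers\<close>

lemma atom_gd_pow: "atom (gd_pow h n) = atom h ^ n"
  by (induct n) (auto simp: gd_delta_def gd_conv_def mult.commute)

lemma measurable_gd_conv:
  assumes [measurable]: "dens h \<in> borel_measurable borel" "dens k \<in> borel_measurable borel"
  shows "dens (gd_conv h k) \<in> borel_measurable borel"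
  by (simp add: gd_conv_def)

lemma measurable_gd_pow:
  assumes "dens h \<in> borel_measurable borel"
  shows "dens (gd_pow h n) \<in> borel_measurable borel"
  using assms by (induct n) (auto simp: measurable_gd_conv, simp add: gd_delta_def)

lemma dens_gd_pow_scale:
  assumes [measurable]: "g \<in> borel_measurable borel"
  shows "dens (gd_pow (GDens 0 (\<lambda>x. c * g x)) k) x = c ^ k * dens (gd_pow (GDens 0 g) k) x"
proof (induct k arbitrary: x)
  case 0
  then show ?case by (simp add: gd_delta_def)
next
  case (Suc k)
  have m[measurable]: "dens (gd_pow (GDens 0 g) k) \<in> borel_measurable borel"
    by (rule measurable_gd_pow) simp
  have "(\<integral>\<^sup>+y. c ^ k * dens (gd_pow (GDens 0 g) k) (x - y) * (c * g y) \<partial>lborel) =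
      c ^ Suc k * (\<integral>\<^sup>+y. dens (gd_pow (GDens 0 g) k) (x - y) * g y \<partial>lborel)"
    by (subst nn_integral_cmult[symmetric]) (auto simp: ac_simps)
  moreover have "0 ^ k * (c * g x) = c ^ Suc k * (0 ^ k * g x)"
    by (cases k) auto
  ultimately show ?case
    by (simp add: gd_conv_def Suc atom_gd_pow distrib_left)
qed

lemma dens_gd_pow_binomial:
  assumes [measurable]: "g \<in> borel_measurable borel"
  shows "dens (gd_pow (GDens a g) n) x =
    (\<Sum>k\<le>n. of_nat (n choose k) * a ^ (n - k) * dens (gd_pow (GDens 0 g) k) x)"
proof (induct n arbitrary: x)
  case 0
  then show ?case by (simp add: gd_delta_def)
next
  case (Suc n)
  define G where "G k = dens (gd_pow (GDens 0 g) k)" for k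
  have [measurable]: "G k \<in> borel_measurable borel" for k
    unfolding G_def by (rule measurable_gd_pow) simp
  have G0: "G 0 y = 0" for y by (simp add: G_def gd_delta_def)
  have GS: "G (Suc k) y = 0 ^ k * g y + (\<integral>\<^sup>+z. G k (y - z) * g z \<partial>lborel)" for k y
    by (simp add: G_def gd_conv_def atom_gd_pow)
  have "dens (gd_pow (GDens a g) (Suc n)) x = a ^ n * g x +
      a * (\<Sum>k\<le>n. of_nat (n choose k) * a ^ (n - k) * G k x) +
      (\<integral>\<^sup>+y. (\<Sum>k\<le>n. of_nat (n choose k) * a ^ (n - k) * G k (x - y)) * g y \<partial>lborel)"
    by (simp add: gd_conv_def atom_gd_pow Suc G_def)
  also have "(\<integral>\<^sup>+y. (\<Sum>k\<le>n. of_nat (n choose k) * a ^ (n - k) * G k (x - y)) * g y \<partial>lborel) =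
      (\<Sum>k\<le>n. of_nat (n choose k) * a ^ (n - k) * (\<integral>\<^sup>+y. G k (x - y) * g y \<partial>lborel))"
    by (simp add: sum_distrib_right nn_integral_sum mult.assoc nn_integral_cmult)
  also have "a ^ n * g x = (\<Sum>k\<le>n. of_nat (n choose k) * a ^ (n - k) * (0 ^ k * g x))"
    by (subst sum.remove[of _ 0]) (auto intro!: sum.neutral)
  also have "a * (\<Sum>k\<le>n. of_nat (n choose k) * a ^ (n - k) * G k x) =
      (\<Sum>k\<le>Suc n. of_nat (n choose k) * a ^ (Suc n - k) * G k x)"
    by (simp add: sum_distrib_left Suc_diff_le ac_simps binomial_eq_0)
  also have "\<dots> = (\<Sum>k\<le>n. of_nat (n choose Suc k) * a ^ (n - k) * G (Suc k) x)"
    by (subst sum.atMost_Suc_shift) (simp add: G0)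
  finally have "dens (gd_pow (GDens a g) (Suc n)) x =
      (\<Sum>k\<le>n. of_nat (n choose k) * a ^ (n - k) * G (Suc k) x) +
      (\<Sum>k\<le>n. of_nat (n choose Suc k) * a ^ (n - k) * G (Suc k) x)"
    by (simp add: GS distrib_left sum.distrib ac_simps)
  also have "\<dots> = (\<Sum>k\<le>n. of_nat (Suc n choose Suc k) * a ^ (n - k) * G (Suc k) x)"
    by (simp add: distrib_right sum.distrib)
  also have "\<dots> = (\<Sum>k\<le>Suc n. of_nat (Suc n choose k) * a ^ (Suc n - k) * G k x)"
    unfolding sum.atMost_Suc_shift by (simp add: G0)
  finally show ?case by (simp only: G_def)
qed

lemma dens_gd_pow_mix:
  assumes "prob_density f" "0 \<le> p" "p \<le> 1"
  shows "dens (gd_pow (gd_mix p f) n) x =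
    (\<Sum>k\<le>n. ennreal (real (n choose k) * (1 - p) ^ k * p ^ (n - k)) *
      dens (gd_pow (GDens 0 (\<lambda>x. ennreal (f x))) k) x)"
proof -
  have [measurable]: "f \<in> borel_measurable borel" using assms by (simp add: prob_density_def)
  have "gd_mix p f = GDens (ennreal p) (\<lambda>x. ennreal (1 - p) * ennreal (f x))"
    using assms by (simp add: gd_mix_def prob_density_def ennreal_mult)
  then have "dens (gd_pow (gd_mix p f) n) x =
    (\<Sum>k\<le>n. of_nat (n choose k) * ennreal p ^ (n - k) *
      dens (gd_pow (GDens 0 (\<lambda>x. ennreal (1 - p) * ennreal (f x))) k) x)"
    by (simp only:) (rule dens_gd_pow_binomial, simp)
  also have "\<dots> = (\<Sum>k\<le>n. of_nat (n choose k) * ennreal p ^ (n - k) *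
      (ennreal (1 - p) ^ k * dens (gd_pow (GDens 0 (\<lambda>x. ennreal (f x))) k) x))"
    by (intro sum.cong arg_cong2[where f = "(*)"] refl dens_gd_pow_scale) simp
  finally show ?thesis
    using assms
    by (simp add: ennreal_mult ennreal_power ennreal_of_nat_eq_real_of_nat ac_simps)
qed

end

theory Submission
  imports Defs
begin

text \<open>
  Let \<open>g = (1 - p) f\<close>, let \<open>h\<^sub>k\<close> be the density part of the \<open>k\<close>-th convolution power of
  \<open>p \<delta> + g\<close>, and let \<open>H = h\<^sub>n\<close>.  The aim is \<open>g \<sim> H / n\<close>, from which the subexponentiality of
  \<open>p \<delta> + g\<close> follows.  Put \<open>a = limsup g / H\<close> and \<open>b = liminf g / H\<close>; both are finite since
  \<open>p\<^sup>n\<^sup>-\<^sup>1 g \<le> H\<close> everywhere.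

  Convolutions are split at the midpoint, into integrals \<open>\<integral>\<^bsub>y \<le> x/2\<^esub> u(y) v(x - y) dy\<close>.  Since
  \<open>H(x - y) \<sim> H(x)\<close> for fixed \<open>y\<close>, Fatou's lemma bounds such an integral, divided by \<open>H(x)\<close>, below
  by \<open>(\<integral> u) liminf v / H\<close> (lemma \<open>tail_ge_half_conv\<close>).  Subexponentiality says that for
  \<open>u = v = H\<close> this bound is attained in the limit.  For \<open>u, v = O(H)\<close>, the lower bounds for the
  complements \<open>C H - u\<close> and \<open>D H - v\<close> then give the upper bound \<open>(\<integral> u) limsup v / H\<close>
  (lemma \<open>tail_le_half_conv\<close>), without any uniformity in \<open>H(x - y) \<sim> H(x)\<close>.

  Inductively, \<open>h\<^sub>k = k p\<^sup>k\<^sup>-\<^sup>1 g + r\<^sub>k\<close> with \<open>limsup r\<^sub>k / H \<le> k (1 - p\<^sup>k\<^sup>-\<^sup>1) a\<close> and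
  \<open>liminf r\<^sub>k / H \<ge> k (1 - p\<^sup>k\<^sup>-\<^sup>1) b\<close> (lemma \<open>gd_pow_tail_decomposition\<close>).  With \<open>P = p\<^sup>n\<^sup>-\<^sup>1\<close>, the
  case \<open>k = n\<close> says that \<open>H = n P g + r\<^sub>n\<close>; taking the limsup and the liminf of \<open>n P g / H\<close> gives
  \<open>n P a + n (1 - P) b \<le> 1 \<le> n P b + n (1 - P) a\<close>, that is, \<open>(2 P - 1) (a - b) \<le> 0\<close>.
  The hypothesis on \<open>p\<close> is exactly \<open>P > 1/2\<close>, so \<open>a = b = 1 / n\<close>.
\<close>

section \<open>Convolutions cut at the midpoint\<close>

text \<open>The part of the convolution at \<open>x\<close> in which the argument of the first factor is at most \<open>x / 2\<close>.\<close>

definition half_conv :: "(real \<Rightarrow> ennreal) \<Rightarrow> (real \<Rightarrow> ennreal) \<Rightarrow> real \<Rightarrow> ennreal" where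
  "half_conv u v x = (\<integral>\<^sup>+y. u y * v (x - y) * indicator {..x / 2} y \<partial>lborel)"

lemma convolution_eq_half_conv:
  assumes [measurable]: "u \<in> borel_measurable borel" "v \<in> borel_measurable borel"
  shows "(\<integral>\<^sup>+y. u (x - y) * v y \<partial>lborel) = half_conv u v x + half_conv v u x"
proof -
  have "(\<integral>\<^sup>+y. u (x - y) * v y \<partial>lborel) =
      (\<integral>\<^sup>+y. v y * u (x - y) * indicator {..x / 2} y + u (x - y) * v y * indicator {x / 2<..} y \<partial>lborel)"
    by (intro nn_integral_cong) (auto simp: indicator_def mult.commute)
  also have "\<dots> = half_conv v u x + (\<integral>\<^sup>+y. u (x - y) * v y * indicator {x / 2<..} y \<partial>lborel)"
    unfolding half_conv_def by (subst nn_integral_add) auto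
  also have "(\<integral>\<^sup>+y. u (x - y) * v y * indicator {x / 2<..} y \<partial>lborel) =
      (\<integral>\<^sup>+y. u y * v (x - y) * indicator {x / 2<..} (x - y) \<partial>lborel)"
    by (subst nn_integral_real_affine[where c="-1" and t=x]) simp_all
  also have "\<dots> = half_conv u v x"
    unfolding half_conv_def using AE_lborel_singleton[of "x / 2"]
    by (intro nn_integral_cong_AE, eventually_elim) (auto simp: indicator_def)
  finally show ?thesis by (simp add: add.commute)
qed

lemma nn_integral_convolution:
  fixes u v :: "real \<Rightarrow> ennreal"
  assumes [measurable]: "u \<in> borel_measurable borel" "v \<in> borel_measurable borel"
  shows "(\<integral>\<^sup>+x. (\<integral>\<^sup>+y. u (x - y) * v y \<partial>lborel) \<partial>lborel) =
    (\<integral>\<^sup>+x. u x \<partial>lborel) * (\<integral>\<^sup>+x. v x \<partial>lborel)"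
proof -
  have shift: "(\<integral>\<^sup>+x. u (x - y) \<partial>lborel) = (\<integral>\<^sup>+x. u x \<partial>lborel)" for y :: real
    using nn_integral_real_affine[of u 1 "- y"] by simp
  have "(\<integral>\<^sup>+x. (\<integral>\<^sup>+y. u (x - y) * v y \<partial>lborel) \<partial>lborel) =
      (\<integral>\<^sup>+y. (\<integral>\<^sup>+x. u (x - y) * v y \<partial>lborel) \<partial>lborel)"
    by (intro lborel_pair.Fubini') simp
  also have "\<dots> = (\<integral>\<^sup>+y. (\<integral>\<^sup>+x. u x \<partial>lborel) * v y \<partial>lborel)"
    by (intro nn_integral_cong, subst nn_integral_multc) (auto simp: shift)
  also have "\<dots> = (\<integral>\<^sup>+x. u x \<partial>lborel) * (\<integral>\<^sup>+x. v x \<partial>lborel)"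
    by (rule nn_integral_cmult) simp
  finally show ?thesis .
qed

lemma half_conv_add_right:
  assumes [measurable]: "u \<in> borel_measurable borel" "v \<in> borel_measurable borel" "w \<in> borel_measurable borel"
  shows "half_conv u (\<lambda>x. v x + w x) x = half_conv u v x + half_conv u w x"
  unfolding half_conv_def
  by (subst nn_integral_add[symmetric]) (auto simp: distrib_left distrib_right)

lemma half_conv_add_left:
  assumes [measurable]: "u \<in> borel_measurable borel" "v \<in> borel_measurable borel" "w \<in> borel_measurable borel"
  shows "half_conv (\<lambda>x. v x + w x) u x = half_conv v u x + half_conv w u x"
  unfolding half_conv_def
  by (subst nn_integral_add[symmetric]) (auto simp: distrib_left distrib_right)

lemma half_conv_cmult_right:
  assumes [measurable]: "u \<in> borel_measurable borel" "v \<in> borel_measurable borel"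
  shows "half_conv u (\<lambda>x. c * v x) x = c * half_conv u v x"
  unfolding half_conv_def
  by (subst nn_integral_cmult[symmetric]) (auto simp: ac_simps)

lemma half_conv_cmult_left:
  assumes [measurable]: "u \<in> borel_measurable borel" "v \<in> borel_measurable borel"
  shows "half_conv (\<lambda>x. c * u x) v x = c * half_conv u v x"
  unfolding half_conv_def
  by (subst nn_integral_cmult[symmetric]) (auto simp: ac_simps)


section \<open>Asymptotic bounds relative to a reference function\<close>

text \<open>
  \<open>tail_le H u a\<close> means \<open>limsup u(x) / H(x) \<le> a\<close> and \<open>tail_ge H u a\<close> means
  \<open>liminf u(x) / H(x) \<ge> a\<close> as \<open>x \<rightarrow> \<infinity>\<close>, stated without division and for real \<open>a\<close>.  As \<open>ennreal\<close> sends
  negative numbers to \<open>0\<close>, \<open>tail_ge H u a\<close> always holds for \<open>a \<le> 0\<close>, and \<open>tail_le H u a\<close> with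
  \<open>a < 0\<close> only says that \<open>u\<close> vanishes eventually.
\<close>

definition tail_le :: "(real \<Rightarrow> ennreal) \<Rightarrow> (real \<Rightarrow> ennreal) \<Rightarrow> real \<Rightarrow> bool" where
  "tail_le H u a \<longleftrightarrow> (\<forall>c>a. eventually (\<lambda>x. u x \<le> ennreal c * H x) at_top)"

definition tail_ge :: "(real \<Rightarrow> ennreal) \<Rightarrow> (real \<Rightarrow> ennreal) \<Rightarrow> real \<Rightarrow> bool" where
  "tail_ge H u a \<longleftrightarrow> (\<forall>c<a. eventually (\<lambda>x. ennreal c * H x \<le> u x) at_top)"

definition eventually_finite_pos :: "(real \<Rightarrow> ennreal) \<Rightarrow> bool" where
  "eventually_finite_pos H \<longleftrightarrow> eventually (\<lambda>x. 0 < H x \<and> H x < \<infinity>) at_top"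

lemma ennreal_diff_upper:
  assumes "A + B \<le> ennreal s * ennreal \<eta>" "ennreal t * ennreal \<eta> \<le> A" "\<eta> \<ge> 0"
  shows "B \<le> ennreal (s - t) * ennreal \<eta>"
proof -
  have "A + B < top"
    by (rule order.strict_trans1[OF assms(1)]) (simp add: ennreal_mult_less_top)
  then obtain \<alpha> \<beta> where AB: "A = ennreal \<alpha>" "B = ennreal \<beta>" "\<alpha> \<ge> 0" "\<beta> \<ge> 0"
    by (cases A; cases B) auto
  have 1: "\<alpha> + \<beta> \<le> max 0 s * \<eta>"
    using assms(1,3) AB by (cases "s \<ge> 0") 
      (auto simp: ennreal_mult[symmetric] ennreal_plus[symmetric] ennreal_neg simp del: ennreal_plus)
  have 2: "t * \<eta> \<le> \<alpha>"
  proof (cases "t \<ge> 0")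
    case True
    then show ?thesis using assms(2,3) AB by (simp add: ennreal_mult[symmetric])
  next
    case False
    then show ?thesis using assms(3) AB(3) by (smt (verit) mult_nonneg_nonneg mult_minus_left)
  qed
  have 3: "\<beta> \<le> max 0 (s - t) * \<eta>"
  proof (cases "s \<ge> 0")
    case True
    have "\<beta> \<le> (s - t) * \<eta>" using 1 2 True by (simp add: algebra_simps)
    also have "\<dots> \<le> max 0 (s - t) * \<eta>" using assms(3) by (intro mult_right_mono) auto
    finally show ?thesis .
  next
    case False
    then have "\<beta> \<le> 0" using 1 AB by simp
    also have "0 \<le> max 0 (s - t) * \<eta>" using assms(3) by simp
    finally show ?thesis .
  qed
  have "B \<le> ennreal (max 0 (s - t) * \<eta>)" using 3 AB by (simp add: ennreal_leI)
  also have "\<dots> = ennreal (s - t) * ennreal \<eta>"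
    using assms(3) by (simp add: ennreal_mult max_def ennreal_neg)
  finally show ?thesis .
qed

lemma ennreal_diff_lower:
  assumes "ennreal s * ennreal \<eta> \<le> A + B" "A \<le> ennreal t * ennreal \<eta>" "\<eta> \<ge> 0" "t \<ge> 0"
  shows "ennreal (s - t) * ennreal \<eta> \<le> B"
proof (cases B)
  case (real \<beta>)
  have "A < top"
    by (rule order.strict_trans1[OF assms(2)]) (simp add: ennreal_mult_less_top)
  then obtain \<alpha> where A: "A = ennreal \<alpha>" "\<alpha> \<ge> 0" by (cases A) auto
  have 2: "\<alpha> \<le> t * \<eta>" using assms A by (simp add: ennreal_mult[symmetric])
  show ?thesis
  proof (cases "s - t \<ge> 0")
    case True
    then have "s * \<eta> \<le> \<alpha> + \<beta>"
      using assms A real by (simp add: ennreal_mult[symmetric] ennreal_plus[symmetric] del: ennreal_plus)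
    then have "(s - t) * \<eta> \<le> \<beta>" using 2 by (simp add: algebra_simps)
    then show ?thesis using True assms(3) real by (simp add: ennreal_mult[symmetric] ennreal_leI)
  next
    case False
    then show ?thesis by (simp add: ennreal_neg)
  qed
qed simp

lemma tail_le_diff:
  assumes H: "eventually_finite_pos H" and w: "tail_le H w s" and u: "tail_ge H u t"
    and eq: "\<And>x. w x = u x + v x"
  shows "tail_le H v (s - t)"
  unfolding tail_le_def
proof safe
  fix c assume c: "c > s - t"
  define e where "e = (c - (s - t)) / 2"
  have e: "e > 0" "c = (s + e) - (t - e)" using c by (auto simp: e_def field_simps)
  have "eventually (\<lambda>x. w x \<le> ennreal (s + e) * H x) at_top" "eventually (\<lambda>x. ennreal (t - e) * H x \<le> u x) at_top"
    using w u e by (auto simp: tail_le_def tail_ge_def simp del: ennreal_plus)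
  with H[unfolded eventually_finite_pos_def] show "eventually (\<lambda>x. v x \<le> ennreal c * H x) at_top"
  proof eventually_elim
    case (elim x)
    then obtain \<eta> where "H x = ennreal \<eta>" "\<eta> \<ge> 0" by (cases "H x") auto
    then show ?case using elim ennreal_diff_upper[of "u x" "v x" "s + e" \<eta> "t - e"] by (simp add: e(2) eq)
  qed
qed

lemma tail_ge_diff:
  assumes H: "eventually_finite_pos H" and w: "tail_ge H w s" and u: "tail_le H u t" "t \<ge> 0"
    and eq: "\<And>x. w x = u x + v x"
  shows "tail_ge H v (s - t)"
  unfolding tail_ge_def
proof safe
  fix c assume c: "c < s - t"
  define e where "e = ((s - t) - c) / 2"
  have e: "e > 0" "c = (s - e) - (t + e)" using c by (auto simp: e_def field_simps)
  have "eventually (\<lambda>x. ennreal (s - e) * H x \<le> w x) at_top" "eventually (\<lambda>x. u x \<le> ennreal (t + e) * H x) at_top"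
    using w u e by (auto simp: tail_le_def tail_ge_def simp del: ennreal_plus)
  with H[unfolded eventually_finite_pos_def] show "eventually (\<lambda>x. ennreal c * H x \<le> v x) at_top"
  proof eventually_elim
    case (elim x)
    then obtain \<eta> where "H x = ennreal \<eta>" "\<eta> \<ge> 0" by (cases "H x") auto
    then show ?case using elim e(1) u(2) ennreal_diff_lower[of "s - e" \<eta> "u x" "v x" "t + e"] by (simp add: e(2) eq)
  qed
qed

lemma tail_le_add:
  assumes "tail_le H u s" "tail_le H v t" "s \<ge> 0" "t \<ge> 0"
  shows "tail_le H (\<lambda>x. u x + v x) (s + t)"
  unfolding tail_le_def
proof safe
  fix c assume c: "c > s + t"
  define e where "e = (c - (s + t)) / 2"
  have e: "e > 0" "c = (s + e) + (t + e)" using c by (auto simp: e_def field_simps)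
  have "eventually (\<lambda>x. u x \<le> ennreal (s + e) * H x) at_top" "eventually (\<lambda>x. v x \<le> ennreal (t + e) * H x) at_top"
    using assms e by (auto simp: tail_le_def simp del: ennreal_plus)
  then show "eventually (\<lambda>x. u x + v x \<le> ennreal c * H x) at_top"
  proof eventually_elim
    case (elim x)
    then have "u x + v x \<le> (ennreal (s + e) + ennreal (t + e)) * H x"
      by (simp only: distrib_right add_mono)
    then show ?case using e assms by (simp add: ennreal_plus[symmetric] del: ennreal_plus)
  qed
qed

lemma tail_ge_add:
  assumes "tail_ge H u s" "tail_ge H v t" "s \<ge> 0" "t \<ge> 0"
  shows "tail_ge H (\<lambda>x. u x + v x) (s + t)"
  unfolding tail_ge_def
proof safe
  fix c assume c: "c < s + t"
  define e where "e = ((s + t) - c) / 2"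
  have e: "e > 0" "c = (s - e) + (t - e)" using c by (auto simp: e_def field_simps)
  have "eventually (\<lambda>x. ennreal (s - e) * H x \<le> u x) at_top" "eventually (\<lambda>x. ennreal (t - e) * H x \<le> v x) at_top"
    using assms e by (auto simp: tail_ge_def)
  then show "eventually (\<lambda>x. ennreal c * H x \<le> u x + v x) at_top"
  proof eventually_elim
    case (elim x)
    have "ennreal c \<le> ennreal (max 0 (s - e) + max 0 (t - e))"
      by (intro ennreal_leI) (auto simp: e(2))
    also have "\<dots> = ennreal (s - e) + ennreal (t - e)" by (simp add: max_def ennreal_neg)
    finally have "ennreal c * H x \<le> (ennreal (s - e) + ennreal (t - e)) * H x"
      by (rule mult_right_mono) simp
    also have "\<dots> \<le> u x + v x" using elim by (simp only: distrib_right add_mono)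
    finally show ?case .
  qed
qed

lemma tail_le_zero: "a \<ge> 0 \<Longrightarrow> tail_le H (\<lambda>x. 0) a"
  and tail_ge_zero: "a \<le> 0 \<Longrightarrow> tail_ge H u a"
  by (auto simp: tail_le_def tail_ge_def ennreal_neg)

lemma tail_le_cmult:
  assumes "tail_le H u s" "k \<ge> 0"
  shows "tail_le H (\<lambda>x. ennreal k * u x) (k * s)"
proof (cases "k = 0")
  case False
  with assms have k: "k > 0" by simp
  show ?thesis unfolding tail_le_def
  proof safe
    fix c assume "c > k * s"
    then have "c / k > s" using k by (simp add: field_simps)
    then have "eventually (\<lambda>x. u x \<le> ennreal (c / k) * H x) at_top" using assms by (auto simp: tail_le_def)
    then show "eventually (\<lambda>x. ennreal k * u x \<le> ennreal c * H x) at_top"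
    proof eventually_elim
      case (elim x)
      then have "ennreal k * u x \<le> ennreal k * (ennreal (c / k) * H x)" by (intro mult_left_mono) auto
      also have "\<dots> = ennreal c * H x" using k by (simp add: ennreal_mult'[symmetric] mult.assoc[symmetric])
      finally show ?case .
    qed
  qed
qed (simp add: tail_le_zero)

lemma tail_ge_cmult:
  assumes "tail_ge H u s" "k \<ge> 0"
  shows "tail_ge H (\<lambda>x. ennreal k * u x) (k * s)"
proof (cases "k = 0")
  case False
  with assms have k: "k > 0" by simp
  show ?thesis unfolding tail_ge_def
  proof safe
    fix c assume "c < k * s"
    then have "c / k < s" using k by (simp add: field_simps)
    then have "eventually (\<lambda>x. ennreal (c / k) * H x \<le> u x) at_top" using assms by (auto simp: tail_ge_def)
    then show "eventually (\<lambda>x. ennreal c * H x \<le> ennreal k * u x) at_top"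
    proof eventually_elim
      case (elim x)
      have "ennreal c * H x = ennreal k * (ennreal (c / k) * H x)"
        using k by (simp add: ennreal_mult'[symmetric] mult.assoc[symmetric])
      also have "\<dots> \<le> ennreal k * u x" using elim by (intro mult_left_mono) auto
      finally show ?case .
    qed
  qed
qed (simp add: tail_ge_zero)

lemma tail_le_refl: "tail_le H H 1" and tail_ge_refl: "tail_ge H H 1"
proof -
  have *: "ennreal a * H x \<le> ennreal b * H x" if "a \<le> b" for a b x
    using that by (intro mult_right_mono ennreal_leI) auto
  show "tail_le H H 1" unfolding tail_le_def using *[of 1] by (auto intro!: always_eventually)
  show "tail_ge H H 1" unfolding tail_ge_def using *[of _ 1] by (auto intro!: always_eventually)
qed

lemma tail_equivI:
  assumes H: "eventually_finite_pos H" and a: "a > 0"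
    and u: "tail_le H u a" "tail_ge H u a" and v: "tail_le H v a" "tail_ge H v a"
  shows "tail_equiv u v"
  unfolding tail_equiv_def
proof -
  have lim: "((\<lambda>x. enn2real (w x) / enn2real (H x)) \<longlongrightarrow> a) at_top \<and>
      eventually (\<lambda>x. 0 < w x \<and> w x < \<infinity>) at_top"
    if w: "tail_le H w a" "tail_ge H w a" for w
  proof (intro conjI order_tendstoI)
    have "eventually (\<lambda>x. w x \<le> ennreal (a + 1) * H x) at_top" "eventually (\<lambda>x. ennreal (a / 2) * H x \<le> w x) at_top"
      using w a by (auto simp: tail_le_def tail_ge_def simp del: ennreal_plus)
    with H[unfolded eventually_finite_pos_def] show fin: "eventually (\<lambda>x. 0 < w x \<and> w x < \<infinity>) at_top"
    proof eventually_elim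
      case (elim x)
      have "0 < ennreal (a / 2) * H x" using elim a by (simp add: ennreal_zero_less_mult_iff)
      moreover have "ennreal (a + 1) * H x < \<infinity>" using elim by (simp add: ennreal_mult_less_top)
      ultimately show ?case using elim by (auto intro: order.strict_trans1 order.strict_trans2)
    qed
    have fin': "eventually (\<lambda>x. \<exists>\<eta> \<omega>. H x = ennreal \<eta> \<and> w x = ennreal \<omega> \<and> \<eta> > 0 \<and> \<omega> > 0) at_top"
      using H[unfolded eventually_finite_pos_def] fin
    proof eventually_elim
      case (elim x)
      then show ?case by (cases "H x"; cases "w x") auto
    qed
    { fix b assume b: "b < a"
      define c where "c = (max 0 b + a) / 2"
      have c: "b < c" "c < a" "c > 0" using a b by (auto simp: c_def)
      have "eventually (\<lambda>x. ennreal c * H x \<le> w x) at_top" using w c by (auto simp: tail_ge_def)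
      with fin' show "eventually (\<lambda>x. b < enn2real (w x) / enn2real (H x)) at_top"
      proof eventually_elim
        case (elim x)
        then obtain \<eta> \<omega> where *: "H x = ennreal \<eta>" "w x = ennreal \<omega>" "\<eta> > 0" "\<omega> > 0" by auto
        then have "c * \<eta> \<le> \<omega>" using elim c by (simp add: ennreal_mult'[symmetric])
        moreover have "b * \<eta> < c * \<eta>" using * c by simp
        ultimately have "b * \<eta> < \<omega>" by linarith
        then show ?case using * by (simp add: field_simps)
      qed }
    { fix b assume b: "a < b"
      define c where "c = (a + b) / 2"
      have c: "c < b" "a < c" "c > 0" using a b by (auto simp: c_def)
      have "eventually (\<lambda>x. w x \<le> ennreal c * H x) at_top" using w c by (auto simp: tail_le_def)
      with fin' show "eventually (\<lambda>x. enn2real (w x) / enn2real (H x) < b) at_top"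
      proof eventually_elim
        case (elim x)
        then obtain \<eta> \<omega> where *: "H x = ennreal \<eta>" "w x = ennreal \<omega>" "\<eta> > 0" "\<omega> > 0" by auto
        then have "\<omega> \<le> c * \<eta>" using elim c by (simp add: ennreal_mult'[symmetric])
        moreover have "c * \<eta> < b * \<eta>" using * c by simp
        ultimately have "\<omega> < b * \<eta>" by linarith
        then show ?case using * by (simp add: field_simps)
      qed }
  qed
  have "((\<lambda>x. (enn2real (u x) / enn2real (H x)) / (enn2real (v x) / enn2real (H x))) \<longlongrightarrow> a / a) at_top"
    using lim[OF u] lim[OF v] a by (intro tendsto_divide) auto
  then have "((\<lambda>x. ennreal ((enn2real (u x) / enn2real (H x)) / (enn2real (v x) / enn2real (H x)))) \<longlongrightarrow> ennreal 1) at_top"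
    using a by (intro tendsto_ennrealI) simp
  moreover have "eventually (\<lambda>x. ennreal ((enn2real (u x) / enn2real (H x)) / (enn2real (v x) / enn2real (H x))) = u x / v x) at_top"
    using H[unfolded eventually_finite_pos_def] lim[OF u, THEN conjunct2] lim[OF v, THEN conjunct2]
  proof eventually_elim
    case (elim x)
    then obtain \<eta> \<alpha> \<beta> where "H x = ennreal \<eta>" "u x = ennreal \<alpha>" "v x = ennreal \<beta>" "\<eta> > 0" "\<alpha> > 0" "\<beta> > 0"
      by (cases "H x"; cases "u x"; cases "v x") auto
    then show ?case by (simp add: divide_ennreal)
  qed
  ultimately show "((\<lambda>x. u x / v x) \<longlongrightarrow> 1) at_top"
    unfolding ennreal_1 by (rule Lim_transform_eventually)
qed


section \<open>Convolution against a subexponential reference function\<close>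

text \<open>
  A reference function \<open>H\<close> of total mass \<open>M\<close> with the tail of a subexponential density.  Besides
  positivity and finiteness for large arguments, it suffices to have \<open>H(x - y) \<ge> (1 - o(1)) H(x)\<close> for each fixed real \<open>y\<close>, of either sign, and an
  upper bound for the half convolution of \<open>H\<close> with itself.
\<close>

locale subexponential_reference =
  fixes H :: "real \<Rightarrow> ennreal" and M :: real
  assumes measurable_H[measurable]: "H \<in> borel_measurable borel"
    and mass_H: "(\<integral>\<^sup>+x. H x \<partial>lborel) = ennreal M" and M_nonneg: "M \<ge> 0"
    and fin_pos: "eventually_finite_pos H"
    and shift_H: "tail_ge H (\<lambda>x. H (x - y)) 1"
    and half_conv_H: "tail_le H (half_conv H H) M"
begin

lemma tail_ge_shift:
  assumes v: "tail_ge H v b"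
  shows "tail_ge H (\<lambda>x. v (x - y)) b"
  unfolding tail_ge_def
proof safe
  fix c assume c: "c < b"
  show "eventually (\<lambda>x. ennreal c * H x \<le> v (x - y)) at_top"
  proof (cases "c > 0")
    case True
    define d where "d = (c + b) / 2"
    have d: "c < d" "d < b" "d > 0" "c / d < 1" using c True by (auto simp: d_def field_simps)
    obtain N where N: "\<And>x. x \<ge> N \<Longrightarrow> ennreal d * H x \<le> v x"
      using v d by (auto simp: tail_ge_def eventually_at_top_linorder)
    have "eventually (\<lambda>x. ennreal (c / d) * H x \<le> H (x - y)) at_top"
      using shift_H[of y] d by (auto simp: tail_ge_def)
    with eventually_ge_at_top[of "N + y"] show ?thesis
    proof eventually_elim
      case (elim x)
      have "ennreal c * H x = ennreal d * (ennreal (c / d) * H x)"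
        using d True by (simp add: ennreal_mult'[symmetric] mult.assoc[symmetric])
      also have "\<dots> \<le> ennreal d * H (x - y)" using elim by (intro mult_left_mono) auto
      also have "\<dots> \<le> v (x - y)" using N[of "x - y"] elim by simp
      finally show ?case .
    qed
  qed (simp add: ennreal_neg)
qed

lemma tail_le_shift:
  assumes v: "tail_le H v a" and a: "a \<ge> 0"
  shows "tail_le H (\<lambda>x. v (x - y)) a"
  unfolding tail_le_def
proof safe
  fix c assume c: "a < c"
  define d where "d = (a + c) / 2"
  have d: "a < d" "d < c" "d > 0" "d / c < 1" using c a by (auto simp: d_def field_simps)
  obtain N where N: "\<And>x. x \<ge> N \<Longrightarrow> v x \<le> ennreal d * H x"
    using v d by (auto simp: tail_le_def eventually_at_top_linorder)
  obtain K where K: "\<And>x. x \<ge> K \<Longrightarrow> ennreal (d / c) * H x \<le> H (x + y)"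
    using shift_H[of "- y", unfolded tail_ge_def, rule_format, OF d(4)]
    by (auto simp: eventually_at_top_linorder)
  show "eventually (\<lambda>x. v (x - y) \<le> ennreal c * H x) at_top"
    using eventually_ge_at_top[of "max N K + y"]
  proof eventually_elim
    case (elim x)
    then have "v (x - y) \<le> ennreal d * H (x - y)" by (intro N) simp
    also have "\<dots> = ennreal c * (ennreal (d / c) * H (x - y))"
      using d by (simp add: ennreal_mult'[symmetric] mult.assoc[symmetric])
    also have "\<dots> \<le> ennreal c * H x" using K[of "x - y"] elim by (intro mult_left_mono) auto
    finally show ?case .
  qed
qed

text \<open>The lower bound is Fatou's lemma along a sequence of counterexamples tending to infinity.\<close>

lemma tail_ge_half_conv:
  assumes [measurable]: "u \<in> borel_measurable borel" "v \<in> borel_measurable borel"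
    and m: "(\<integral>\<^sup>+x. u x \<partial>lborel) = ennreal m" "m \<ge> 0" and v: "tail_ge H v b"
  shows "tail_ge H (half_conv u v) (b * m)"
  unfolding tail_ge_def
proof safe
  fix d assume d: "d < b * m"
  show "eventually (\<lambda>x. ennreal d * H x \<le> half_conv u v x) at_top"
  proof (rule ccontr)
    assume not: "\<not> ?thesis"
    then have "d > 0" by (rule contrapos_np) (simp add: ennreal_neg)
    then have "b * m > 0" using d by linarith
    then have m0: "m > 0" and b0: "b > 0" using m(2) by (auto simp: zero_less_mult_iff)
    define c where "c = (d / m + b) / 2"
    have c: "d < c * m" "c < b" "c > 0"
      using d m0 b0 \<open>d > 0\<close> by (auto simp: c_def field_simps add_pos_pos)
    obtain X :: "nat \<Rightarrow> real" where X: "\<And>i. X i \<ge> real i" "\<And>i. half_conv u v (X i) < ennreal d * H (X i)"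
    proof -
      have "\<forall>i. \<exists>x. x \<ge> real i \<and> half_conv u v x < ennreal d * H x"
        using not by (simp add: eventually_at_top_linorder not_le)
      then show ?thesis using that by metis
    qed
    have X_top: "filterlim X at_top sequentially"
      by (rule filterlim_at_top_mono[OF filterlim_real_sequentially]) (simp add: X)
    \<comment> \<open>For fixed \<open>y\<close> the cut-off is eventually inactive, and \<open>v (X i - y)\<close> is at least
      \<open>c * H (X i)\<close> for large \<open>i\<close>.\<close>
    define F where "F i y = u y * v (X i - y) * indicator {..X i / 2} y / H (X i)" for i y
    have lower: "ennreal c * u y \<le> liminf (\<lambda>i. F i y)" for y
    proof (rule Liminf_bounded)
      have "eventually (\<lambda>x. ennreal c * H x \<le> v (x - y)) at_top"
        using tail_ge_shift[OF v, of y] c by (auto simp: tail_ge_def)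
      then have "eventually (\<lambda>x. ennreal c * u y \<le> u y * v (x - y) * indicator {..x / 2} y / H x) at_top"
        using fin_pos[unfolded eventually_finite_pos_def] eventually_ge_at_top[of "2 * y"]
      proof eventually_elim
        case (elim x)
        have "ennreal c * u y = ennreal c * u y * H x / H x"
          using elim by (subst ennreal_mult_divide_eq) auto
        also have "\<dots> = u y * (ennreal c * H x) / H x" by (simp add: ac_simps)
        also have "\<dots> \<le> u y * v (x - y) / H x"
          using elim by (intro divide_right_mono_ennreal mult_left_mono) auto
        finally show ?case using elim by simp
      qed
      from filterlim_iff[THEN iffD1, OF X_top, rule_format, OF this]
      show "eventually (\<lambda>i. ennreal c * u y \<le> F i y) sequentially" by (simp add: F_def)
    qed
    have [measurable]: "F i \<in> borel_measurable borel" for i unfolding F_def by measurable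
    have int: "(\<integral>\<^sup>+y. F i y \<partial>lborel) = half_conv u v (X i) / H (X i)" for i
      unfolding F_def half_conv_def by (rule nn_integral_divide) simp
    have "eventually (\<lambda>i. 0 < H (X i) \<and> H (X i) < \<infinity>) sequentially"
      by (rule filterlim_iff[THEN iffD1, OF X_top, rule_format]) (use fin_pos in \<open>simp add: eventually_finite_pos_def\<close>)
    then have upper: "eventually (\<lambda>i. (\<integral>\<^sup>+y. F i y \<partial>lborel) \<le> ennreal d) sequentially"
    proof eventually_elim
      case (elim i)
      have "half_conv u v (X i) / H (X i) \<le> ennreal d * H (X i) / H (X i)"
        using X(2)[of i] by (intro divide_right_mono_ennreal) simp
      also have "\<dots> = ennreal d" using elim by (intro ennreal_mult_divide_eq) auto
      finally show ?case by (simp add: int)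
    qed
    have "ennreal (c * m) = (\<integral>\<^sup>+y. ennreal c * u y \<partial>lborel)"
      using c m by (simp add: nn_integral_cmult ennreal_mult)
    also have "\<dots> \<le> (\<integral>\<^sup>+y. liminf (\<lambda>i. F i y) \<partial>lborel)"
      by (intro nn_integral_mono lower)
    also have "\<dots> \<le> liminf (\<lambda>i. \<integral>\<^sup>+y. F i y \<partial>lborel)"
      by (rule nn_integral_liminf) simp
    also have "\<dots> \<le> ennreal d" by (rule Liminf_le[OF _ upper]) simp
    finally show False using c \<open>d > 0\<close> by (simp add: ennreal_le_iff)
  qed
qed

text \<open>
  The upper bound comes from the sharp bound for \<open>H\<close> with \<open>H\<close> by subtracting lower bounds: passing
  to the complement of \<open>u\<close> in \<open>C H\<close> bounds the half convolution of \<open>u\<close> with \<open>H\<close>, and then passing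
  to the complement of \<open>v\<close> in \<open>D H\<close> bounds that of \<open>u\<close> with \<open>v\<close>.  Domination for
  large arguments only would not do, as the integral runs over all \<open>y \<le> x / 2\<close>.
\<close>

lemma tail_le_half_conv:
  assumes [measurable]: "u \<in> borel_measurable borel" "v \<in> borel_measurable borel"
    and u: "\<And>x. u x \<le> ennreal C * H x" "C \<ge> 0"
    and v: "\<And>x. v x \<le> ennreal D * H x" "D \<ge> 0"
    and m: "(\<integral>\<^sup>+x. u x \<partial>lborel) = ennreal m" "m \<ge> 0"
    and a: "tail_le H v a" "a \<ge> 0"
  shows "tail_le H (half_conv u v) (a * m)"
proof -
  \<comment> \<open>Where \<open>H\<close> is infinite, \<open>u' + u = C H\<close> still holds, as \<open>u \<le> C H\<close>.\<close>
  define u' where "u' x = ennreal C * H x - u x" for x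
  define v' where "v' x = ennreal D * H x - v x" for x
  have [measurable]: "u' \<in> borel_measurable borel" "v' \<in> borel_measurable borel"
    unfolding u'_def v'_def by measurable
  have uu: "ennreal C * H x = u' x + u x" and vv: "ennreal D * H x = v x + v' x"
      and vv': "ennreal D * H x = v' x + v x" for x
    using u(1) v(1) by (simp_all add: u'_def v'_def add.commute add_diff_inverse_ennreal diff_add_cancel_ennreal)
  have "ennreal (C * M) = (\<integral>\<^sup>+x. ennreal C * H x \<partial>lborel)"
    using u(2) M_nonneg by (simp add: nn_integral_cmult mass_H ennreal_mult)
  also have "\<dots> = (\<integral>\<^sup>+x. u' x \<partial>lborel) + ennreal m"
    unfolding uu by (simp add: nn_integral_add m)
  finally have CM: "ennreal (C * M) = (\<integral>\<^sup>+x. u' x \<partial>lborel) + ennreal m" .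
  then have le: "ennreal m \<le> ennreal (C * M)" by simp
  then have "m \<le> C * M" using u(2) M_nonneg by (simp add: ennreal_le_iff)
  moreover have u'_mass: "(\<integral>\<^sup>+x. u' x \<partial>lborel) = ennreal (C * M - m)"
    using CM m by (simp add: ennreal_minus[symmetric])
  ultimately have lower: "tail_ge H (half_conv u' H) (1 * (C * M - m))"
    by (intro tail_ge_half_conv tail_ge_refl) auto
  have "tail_le H (half_conv u H) (C * M - 1 * (C * M - m))"
  proof (rule tail_le_diff[OF fin_pos _ lower])
    show "tail_le H (\<lambda>x. ennreal C * half_conv H H x) (C * M)"
      by (intro tail_le_cmult half_conv_H u)
    show "ennreal C * half_conv H H x = half_conv u' H x + half_conv u H x" for x
      unfolding half_conv_cmult_left[OF measurable_H measurable_H, symmetric] uu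
      by (rule half_conv_add_left) auto
  qed
  then have uH: "tail_le H (\<lambda>x. ennreal D * half_conv u H x) (D * m)"
    by (intro tail_le_cmult v) simp
  have "tail_ge H (\<lambda>x. ennreal D * H x) (D * 1)"
    by (intro tail_ge_cmult tail_ge_refl v)
  then have "tail_ge H v' (D * 1 - a)"
    by (rule tail_ge_diff[OF fin_pos _ a vv])
  then have lower': "tail_ge H (half_conv u v') ((D * 1 - a) * m)"
    by (intro tail_ge_half_conv m) auto
  have "tail_le H (half_conv u v) (D * m - (D * 1 - a) * m)"
  proof (rule tail_le_diff[OF fin_pos uH lower'])
    show "ennreal D * half_conv u H x = half_conv u v' x + half_conv u v x" for x
      unfolding half_conv_cmult_right[OF \<open>u \<in> _\<close> measurable_H, symmetric] vv'
      by (rule half_conv_add_right) auto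
  qed
  then show ?thesis by (simp add: algebra_simps)
qed

lemma tail_le_convolution:
  assumes [measurable]: "u \<in> borel_measurable borel" "v \<in> borel_measurable borel"
    and u: "\<And>x. u x \<le> ennreal C * H x" "C \<ge> 0"
    and v: "\<And>x. v x \<le> ennreal D * H x" "D \<ge> 0"
    and mu: "(\<integral>\<^sup>+x. u x \<partial>lborel) = ennreal mu" "mu \<ge> 0"
    and mv: "(\<integral>\<^sup>+x. v x \<partial>lborel) = ennreal mv" "mv \<ge> 0"
    and a: "tail_le H u a" "a \<ge> 0" and b: "tail_le H v b" "b \<ge> 0"
  shows "tail_le H (\<lambda>x. \<integral>\<^sup>+y. u (x - y) * v y \<partial>lborel) (b * mu + a * mv)"
  unfolding convolution_eq_half_conv[OF assms(1,2)]
proof (rule tail_le_add)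
  show "tail_le H (half_conv u v) (b * mu)"
    using u v mu b by (intro tail_le_half_conv[where C=C and D=D]) auto
  show "tail_le H (half_conv v u) (a * mv)"
    using u v mv a by (intro tail_le_half_conv[where C=D and D=C]) auto
qed (use mu mv a b in auto)

lemma tail_ge_convolution:
  assumes [measurable]: "u \<in> borel_measurable borel" "v \<in> borel_measurable borel"
    and mu: "(\<integral>\<^sup>+x. u x \<partial>lborel) = ennreal mu" "mu \<ge> 0"
    and mv: "(\<integral>\<^sup>+x. v x \<partial>lborel) = ennreal mv" "mv \<ge> 0"
    and a: "tail_ge H u a" "a \<ge> 0" and b: "tail_ge H v b" "b \<ge> 0"
  shows "tail_ge H (\<lambda>x. \<integral>\<^sup>+y. u (x - y) * v y \<partial>lborel) (b * mu + a * mv)"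
  unfolding convolution_eq_half_conv[OF assms(1,2)]
proof (rule tail_ge_add)
  show "tail_ge H (half_conv u v) (b * mu)"
    using mu b by (intro tail_ge_half_conv) auto
  show "tail_ge H (half_conv v u) (a * mv)"
    using mv a by (intro tail_ge_half_conv) auto
qed (use mu mv a b in auto)

lemma tail_ge_le_tail_le:
  assumes "tail_ge H u b" "tail_le H u a" "a \<ge> 0"
  shows "b \<le> a"
proof (rule ccontr)
  assume "\<not> b \<le> a"
  then obtain c d where cd: "a < c" "c < d" "d < b" by (meson dense not_le)
  have "eventually (\<lambda>x. u x \<le> ennreal c * H x) at_top" "eventually (\<lambda>x. ennreal d * H x \<le> u x) at_top"
    using assms cd by (auto simp: tail_le_def tail_ge_def)
  with fin_pos[unfolded eventually_finite_pos_def] have "eventually (\<lambda>x::real. False) at_top"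
  proof eventually_elim
    case (elim x)
    then obtain \<eta> where \<eta>: "H x = ennreal \<eta>" "\<eta> > 0" by (cases "H x") auto
    have "ennreal d * H x \<le> ennreal c * H x" using elim by (blast intro: order_trans)
    then show ?case using \<eta> cd assms(3) by (simp add: ennreal_mult'[symmetric] ennreal_le_iff)
  qed
  then show False by simp
qed

text \<open>The least upper and the greatest lower bound are the limsup and the liminf of \<open>u / H\<close>.\<close>

lemma tail_le_optimal:
  assumes "tail_le H u D" "D \<ge> 0"
  obtains a where "a \<ge> 0" "tail_le H u a" "\<And>c. c \<ge> 0 \<Longrightarrow> tail_le H u c \<Longrightarrow> a \<le> c"
proof
  define S where "S = {c. c \<ge> 0 \<and> tail_le H u c}"
  have S: "S \<noteq> {}" "bdd_below S" using assms by (auto simp: S_def intro!: bdd_belowI[of _ 0])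
  show "Inf S \<ge> 0" using S by (intro cInf_greatest) (auto simp: S_def)
  show "Inf S \<le> c" if "c \<ge> 0" "tail_le H u c" for c
    using S that by (intro cInf_lower) (auto simp: S_def)
  show "tail_le H u (Inf S)"
    unfolding tail_le_def using cInf_lessD[OF S(1)] by (fastforce simp: S_def tail_le_def)
qed

lemma tail_ge_optimal:
  assumes "tail_le H u D" "D \<ge> 0"
  obtains b where "b \<ge> 0" "tail_ge H u b" "\<And>c. tail_ge H u c \<Longrightarrow> c \<le> b"
proof
  define S where "S = {c. tail_ge H u c}"
  have S: "0 \<in> S" "bdd_above S"
    using assms tail_ge_le_tail_le by (auto simp: S_def tail_ge_zero intro!: bdd_aboveI[of _ D])
  show "Sup S \<ge> 0" using S by (intro cSup_upper) auto
  show "c \<le> Sup S" if "tail_ge H u c" for c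
    using S that by (intro cSup_upper) (auto simp: S_def)
  show "tail_ge H u (Sup S)"
    unfolding tail_ge_def using less_cSupD[of S] S(1) by (fastforce simp: S_def tail_ge_def)
qed

end


section \<open>Convolution powers of generalized densities\<close>

lemma dens_gd_pow_Suc:
  "dens (gd_pow (GDens a g) (Suc k)) x = a ^ k * g x + a * dens (gd_pow (GDens a g) k) x +
    (\<integral>\<^sup>+y. dens (gd_pow (GDens a g) k) (x - y) * g y \<partial>lborel)"
  by (simp add: gd_conv_def atom_gd_pow)

lemma dens_gd_pow_2:
  "dens (gd_pow h 2) x = 2 * (atom h * dens h x) + (\<integral>\<^sup>+y. dens h (x - y) * dens h y \<partial>lborel)"
  by (simp add: numeral_2_eq_2 gd_conv_def gd_delta_def) (simp add: mult_2[symmetric] numeral_2_eq_2[symmetric])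

lemma nn_integral_dens_gd_pow:
  assumes [measurable]: "g \<in> borel_measurable borel"
    and g: "(\<integral>\<^sup>+x. g x \<partial>lborel) = ennreal (1 - p)" and p: "0 \<le> p" "p \<le> 1"
  shows "(\<integral>\<^sup>+x. dens (gd_pow (GDens (ennreal p) g) k) x \<partial>lborel) = ennreal (1 - p ^ k)"
proof (induct k)
  case 0
  then show ?case by (simp add: gd_delta_def)
next
  case (Suc k)
  let ?h = "dens (gd_pow (GDens (ennreal p) g) k)"
  have [measurable]: "?h \<in> borel_measurable borel" by (rule measurable_gd_pow) simp
  have pk: "0 \<le> p ^ k" "p ^ k \<le> 1" using p by (auto intro: power_le_one)
  have "(\<integral>\<^sup>+x. dens (gd_pow (GDens (ennreal p) g) (Suc k)) x \<partial>lborel) =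
      ennreal p ^ k * ennreal (1 - p) + ennreal p * ennreal (1 - p ^ k) + ennreal (1 - p ^ k) * ennreal (1 - p)"
    unfolding dens_gd_pow_Suc
    by (simp add: nn_integral_add nn_integral_cmult nn_integral_convolution Suc g)
  also have "\<dots> = ennreal (p ^ k * (1 - p) + p * (1 - p ^ k) + (1 - p ^ k) * (1 - p))"
    using p pk by (simp add: ennreal_power ennreal_mult ennreal_plus)
  also have "p ^ k * (1 - p) + p * (1 - p ^ k) + (1 - p ^ k) * (1 - p) = 1 - p ^ Suc k"
    by (simp add: algebra_simps)
  finally show ?case .
qed

lemma dens_gd_pow_mono:
  assumes "k \<le> n"
  shows "a ^ (n - k) * dens (gd_pow (GDens a g) k) x \<le> dens (gd_pow (GDens a g) n) x"
  using assms
proof (induct n rule: dec_induct)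
  case (step n)
  have "a ^ (Suc n - k) * dens (gd_pow (GDens a g) k) x = a * (a ^ (n - k) * dens (gd_pow (GDens a g) k) x)"
    using step(1) by (simp add: Suc_diff_le mult.assoc)
  also have "\<dots> \<le> a * dens (gd_pow (GDens a g) n) x" using step(3) by (rule mult_left_mono) simp
  also have "\<dots> \<le> dens (gd_pow (GDens a g) (Suc n)) x"
    unfolding dens_gd_pow_Suc by (simp add: add_increasing add_increasing2)
  finally show ?case .
qed simp

text \<open>
  The remainders satisfy \<open>r\<^sub>k\<^sub>+\<^sub>1 = p r\<^sub>k + h\<^sub>k * g\<close>.  The multiple of \<open>g(x)\<close> itself is kept apart because
  the final comparison solves \<open>H = n p\<^sup>n\<^sup>-\<^sup>1 g + r\<^sub>n\<close> for \<open>g\<close>, which pairs the limsup of \<open>g / H\<close> with the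
  liminf of \<open>r\<^sub>n / H\<close>.
\<close>

lemma (in subexponential_reference) gd_pow_tail_decomposition:
  assumes [measurable]: "g \<in> borel_measurable borel"
    and g: "(\<integral>\<^sup>+x. g x \<partial>lborel) = ennreal (1 - p)" and p: "0 \<le> p" "p \<le> 1"
    and g_le: "\<And>x. g x \<le> ennreal D * H x" "D \<ge> 0"
    and pow_le: "\<And>k x. k \<le> n \<Longrightarrow> dens (gd_pow (GDens (ennreal p) g) k) x \<le> ennreal (C k) * H x"
      "\<And>k. C k \<ge> 0"
    and a: "tail_le H g a" "a \<ge> 0" and b: "tail_ge H g b" "b \<ge> 0"
  shows "k \<le> n \<Longrightarrow> \<exists>r. (\<forall>x. dens (gd_pow (GDens (ennreal p) g) k) x = ennreal (k * p ^ (k - 1)) * g x + r x) \<and>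
    tail_le H r (k * (1 - p ^ (k - 1)) * a) \<and> tail_ge H r (k * (1 - p ^ (k - 1)) * b)"
proof (induct k)
  case 0
  then show ?case by (intro exI[of _ "\<lambda>x. 0"]) (simp add: gd_delta_def tail_le_zero tail_ge_zero)
next
  case (Suc k)
  let ?h = "dens (gd_pow (GDens (ennreal p) g) k)"
  define conv where "conv x = (\<integral>\<^sup>+y. ?h (x - y) * g y \<partial>lborel)" for x
  have [measurable]: "?h \<in> borel_measurable borel" by (rule measurable_gd_pow) simp
  have pk: "0 \<le> p ^ k" "p ^ k \<le> 1" "0 \<le> p ^ (k - 1)" "p ^ (k - 1) \<le> 1" using p by (auto intro: power_le_one)
  \<comment> \<open>In natural numbers \<open>0 - 1 = 0\<close>, which is harmless because of the factor \<open>k\<close>.\<close>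
  have kp: "real k * p ^ (k - 1) * p = real k * p ^ k" by (cases k) auto
  from Suc obtain r where r: "\<And>x. ?h x = ennreal (k * p ^ (k - 1)) * g x + r x"
      "tail_le H r (k * (1 - p ^ (k - 1)) * a)" "tail_ge H r (k * (1 - p ^ (k - 1)) * b)"
    by auto
  have nn: "0 \<le> k * (1 - p ^ (k - 1)) * a" "0 \<le> k * (1 - p ^ (k - 1)) * b" "0 \<le> k * p ^ (k - 1)"
    using pk a b by (auto intro!: mult_nonneg_nonneg)
  have h_eq: "?h = (\<lambda>x. ennreal (k * p ^ (k - 1)) * g x + r x)" using r(1) by auto
  have "tail_le H ?h (k * p ^ (k - 1) * a + k * (1 - p ^ (k - 1)) * a)"
    unfolding h_eq using a nn r by (intro tail_le_add tail_le_cmult) auto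
  then have h_le: "tail_le H ?h (k * a)" by (simp add: algebra_simps)
  have "tail_ge H ?h (k * p ^ (k - 1) * b + k * (1 - p ^ (k - 1)) * b)"
    unfolding h_eq using b nn r by (intro tail_ge_add tail_ge_cmult) auto
  then have h_ge: "tail_ge H ?h (k * b)" by (simp add: algebra_simps)
  note mass = nn_integral_dens_gd_pow[OF assms(1) g p, of k]
  have conv_le: "tail_le H conv (a * (1 - p ^ k) + k * a * (1 - p))"
    unfolding conv_def using pow_le(1)[of k] Suc(2) pow_le(2) g_le mass g h_le a p pk
    by (intro tail_le_convolution[where C="C k" and D=D]) auto
  have conv_ge: "tail_ge H conv (b * (1 - p ^ k) + k * b * (1 - p))"
    unfolding conv_def using mass g h_ge b p pk
    by (intro tail_ge_convolution) auto
  show ?case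
  proof (intro exI conjI allI)
    fix x
    have "dens (gd_pow (GDens (ennreal p) g) (Suc k)) x =
        ennreal (p ^ k) * g x + ennreal p * (ennreal (k * p ^ (k - 1)) * g x + r x) + conv x"
      unfolding dens_gd_pow_Suc r(1)[symmetric] conv_def using p by (simp add: ennreal_power)
    also have "\<dots> = (ennreal (p ^ k) + ennreal (k * p ^ (k - 1) * p)) * g x + (ennreal p * r x + conv x)"
      using p nn by (simp add: ennreal_mult distrib_left distrib_right ac_simps)
    also have "ennreal (p ^ k) + ennreal (k * p ^ (k - 1) * p) = ennreal (p ^ k + k * p ^ k)"
      unfolding kp using pk by (simp add: ennreal_plus)
    also have "p ^ k + k * p ^ k = Suc k * p ^ (Suc k - 1)" by (simp add: algebra_simps)
    finally show "dens (gd_pow (GDens (ennreal p) g) (Suc k)) x =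
        ennreal (Suc k * p ^ (Suc k - 1)) * g x + (ennreal p * r x + conv x)" .
  next
    have "tail_le H (\<lambda>x. ennreal p * r x + conv x)
        (p * (k * (1 - p ^ (k - 1)) * a) + (a * (1 - p ^ k) + k * a * (1 - p)))"
      using r(2) p a pk nn conv_le by (intro tail_le_add tail_le_cmult) auto
    also have "p * (k * (1 - p ^ (k - 1)) * a) + (a * (1 - p ^ k) + k * a * (1 - p)) =
        (p * k - k * p ^ (k - 1) * p) * a + (a * (1 - p ^ k) + k * a * (1 - p))"
      by (simp add: algebra_simps)
    also have "\<dots> = Suc k * (1 - p ^ (Suc k - 1)) * a"
      unfolding kp by (simp add: algebra_simps)
    finally show "tail_le H (\<lambda>x. ennreal p * r x + conv x) (Suc k * (1 - p ^ (Suc k - 1)) * a)" .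
  next
    have "tail_ge H (\<lambda>x. ennreal p * r x + conv x)
        (p * (k * (1 - p ^ (k - 1)) * b) + (b * (1 - p ^ k) + k * b * (1 - p)))"
      using r(3) p b pk nn conv_ge by (intro tail_ge_add tail_ge_cmult) auto
    also have "p * (k * (1 - p ^ (k - 1)) * b) + (b * (1 - p ^ k) + k * b * (1 - p)) =
        (p * k - k * p ^ (k - 1) * p) * b + (b * (1 - p ^ k) + k * b * (1 - p))"
      by (simp add: algebra_simps)
    also have "\<dots> = Suc k * (1 - p ^ (Suc k - 1)) * b"
      unfolding kp by (simp add: algebra_simps)
    finally show "tail_ge H (\<lambda>x. ennreal p * r x + conv x) (Suc k * (1 - p ^ (Suc k - 1)) * b)" .
  qed
qed


section \<open>Subexponentiality of convolution roots\<close>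

lemma tail_equivD:
  assumes "tail_equiv u v"
  shows "eventually_finite_pos v" "tail_le v u 1" "tail_ge v u 1"
proof -
  have lim: "((\<lambda>x. u x / v x) \<longlongrightarrow> 1) at_top" using assms by (simp add: tail_equiv_def)
  have "eventually (\<lambda>x. 0 < u x / v x) at_top" "eventually (\<lambda>x. u x / v x < \<infinity>) at_top"
    by (rule order_tendstoD[OF lim], simp)+
  then show fin: "eventually_finite_pos v" unfolding eventually_finite_pos_def
  proof eventually_elim
    case (elim x)
    then have "v x \<noteq> 0"
      by (cases "u x = 0") (auto simp: ennreal_divide_zero ennreal_top_divide)
    moreover have "v x \<noteq> \<infinity>" using elim by auto
    ultimately show ?case by (simp add: less_top zero_less_iff_neq_zero)
  qed
  have eq: "u x = u x / v x * v x" if "0 < v x \<and> v x < \<infinity>" for x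
    using that ennreal_mult_divide_eq[of "v x" "u x"] by (auto simp: divide_ennreal_def ac_simps)
  show "tail_le v u 1" unfolding tail_le_def
  proof safe
    fix c :: real assume "c > 1"
    then have "eventually (\<lambda>x. u x / v x < ennreal c) at_top" by (intro order_tendstoD[OF lim]) simp
    with fin[unfolded eventually_finite_pos_def] show "eventually (\<lambda>x. u x \<le> ennreal c * v x) at_top"
    proof eventually_elim
      case (elim x)
      show ?case by (subst eq) (use elim in \<open>auto intro!: mult_right_mono\<close>)
    qed
  qed
  show "tail_ge v u 1" unfolding tail_ge_def
  proof safe
    fix c :: real assume "c < 1"
    then have "eventually (\<lambda>x. u x / v x > ennreal c) at_top" by (intro order_tendstoD[OF lim]) (simp add: ennreal_less_one_iff)
    with fin[unfolded eventually_finite_pos_def] show "eventually (\<lambda>x. ennreal c * v x \<le> u x) at_top"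
    proof eventually_elim
      case (elim x)
      show ?case by (subst eq) (use elim in \<open>auto intro!: mult_right_mono\<close>)
    qed
  qed
qed

text \<open>
  For \<open>h = q \<delta> + H\<close> the convolution square has density \<open>2 q H + H * H\<close>, and \<open>H * H\<close> is twice the
  half convolution of \<open>H\<close> with itself.  So \<open>h\<^sup>*\<^sup>2 \<sim> 2 H\<close> bounds the latter by
  \<open>(1 - q) H\<close> asymptotically.
\<close>

lemma subexponential_reference_dens:
  assumes h: "subexponential h" and [measurable]: "dens h \<in> borel_measurable borel"
    and atom: "atom h = ennreal q" and mass: "(\<integral>\<^sup>+x. dens h x \<partial>lborel) = ennreal (1 - q)"
    and q: "0 \<le> q" "q \<le> 1"
  shows "subexponential_reference (dens h) (1 - q)"
proof
  have shift: "tail_equiv (\<lambda>x. dens h (x + y)) (dens h)" if "y > 0" for y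
    using h that by (auto simp: subexponential_def long_tailed_def)
  show fin: "eventually_finite_pos (dens h)" using tail_equivD(1)[OF shift[of 1]] by simp
  show "tail_ge (dens h) (\<lambda>x. dens h (x - y)) 1" for y
  proof (cases y "0 :: real" rule: linorder_cases)
    case less
    then show ?thesis using tail_equivD(3)[OF shift[of "- y"]] by simp
  next
    case equal
    then show ?thesis by (simp add: tail_ge_refl)
  next
    case greater
    show ?thesis unfolding tail_ge_def
    proof safe
      fix c :: real assume c: "c < 1"
      show "eventually (\<lambda>x. ennreal c * dens h x \<le> dens h (x - y)) at_top"
      proof (cases "c > 0")
        case True
        then have "1 / c > 1" using c by simp
        then obtain N where N: "\<And>x. x \<ge> N \<Longrightarrow> dens h (x + y) \<le> ennreal (1 / c) * dens h x"
          using tail_equivD(2)[OF shift[OF greater]] unfolding tail_le_def eventually_at_top_linorder by blast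
        have "ennreal c * dens h x \<le> dens h (x - y)" if "x \<ge> N + y" for x
        proof -
          have "ennreal c * dens h x \<le> ennreal c * (ennreal (1 / c) * dens h (x - y))"
            using N[of "x - y"] that by (intro mult_left_mono) auto
          also have "\<dots> = dens h (x - y)"
            using True by (simp add: ennreal_mult'[symmetric] mult.assoc[symmetric])
          finally show ?thesis .
        qed
        then show ?thesis by (auto simp: eventually_at_top_linorder)
      qed (simp add: ennreal_neg)
    qed
  qed
  have eq: "tail_equiv (dens (gd_pow h 2)) (\<lambda>x. 2 * dens h x)"
    using h by (simp add: subexponential_def)
  have "tail_le (dens h) (dens (gd_pow h 2)) 2" unfolding tail_le_def
  proof safe
    fix c :: real assume c: "c > 2"
    then have "eventually (\<lambda>x. dens (gd_pow h 2) x \<le> ennreal (c / 2) * (2 * dens h x)) at_top"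
      using tail_equivD(2)[OF eq] by (auto simp: tail_le_def)
    moreover have "ennreal (c / 2) * (2 * t) = ennreal c * t" for t
    proof -
      have "ennreal (c / 2) * 2 = ennreal c"
        using c ennreal_mult[of "c / 2" 2] by simp
      then show ?thesis by (simp add: mult.assoc[symmetric])
    qed
    ultimately show "eventually (\<lambda>x. dens (gd_pow h 2) x \<le> ennreal c * dens h x) at_top" by simp
  qed
  moreover have "tail_ge (dens h) (\<lambda>x. ennreal (2 * q) * dens h x) (2 * q * 1)"
    using q by (intro tail_ge_cmult tail_ge_refl) auto
  ultimately have "tail_le (dens h) (\<lambda>x. 2 * half_conv (dens h) (dens h) x) (2 - 2 * q * 1)"
    by (rule tail_le_diff[OF fin])
      (use q in \<open>simp add: dens_gd_pow_2 atom convolution_eq_half_conv mult_2[symmetric] ennreal_mult mult.assoc\<close>)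
  then have "tail_le (dens h) (\<lambda>x. ennreal (1 / 2) * (2 * half_conv (dens h) (dens h) x)) (1 / 2 * (2 - 2 * q * 1))"
    by (rule tail_le_cmult) simp
  moreover have "ennreal (1 / 2) * (2 * t) = t" for t
    using ennreal_mult[of "1 / 2" 2] by (simp add: mult.assoc[symmetric])
  moreover have "1 / 2 * (2 - 2 * q * 1) = 1 - q" by simp
  ultimately show "tail_le (dens h) (half_conv (dens h) (dens h)) (1 - q)" by (simp only:)
qed (use assms in auto)

lemma subexponential_convolution_root:
  assumes meas[measurable]: "g \<in> borel_measurable borel"
    and mass: "(\<integral>\<^sup>+x. g x \<partial>lborel) = ennreal (1 - p)" and p: "0 < p" "p < 1"
    and n: "n \<ge> 1" and p_large: "p ^ (n - 1) > 1 / 2"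
    and sub: "subexponential (gd_pow (GDens (ennreal p) g) n)"
  shows "subexponential (GDens (ennreal p) g)"
proof -
  define H where "H = dens (gd_pow (GDens (ennreal p) g) n)"
  define P where "P = p ^ (n - 1)"
  have P: "1 / 2 < P" "P \<le> 1" "0 < real n * P" using p p_large n by (auto simp: P_def intro!: power_le_one)
  have n0: "real n > 0" using n by simp
  interpret subexponential_reference H "1 - p ^ n"
    unfolding H_def using sub p
    by (intro subexponential_reference_dens measurable_gd_pow)
       (auto simp: atom_gd_pow ennreal_power nn_integral_dens_gd_pow[OF meas mass] power_le_one)
  define C where "C k = 1 / p ^ (n - k)" for k
  have C: "C k \<ge> 0" for k using p by (simp add: C_def)
  have pow_le: "dens (gd_pow (GDens (ennreal p) g) k) x \<le> ennreal (C k) * H x" if "k \<le> n" for k x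
  proof -
    have "dens (gd_pow (GDens (ennreal p) g) k) x =
        ennreal (C k) * (ennreal p ^ (n - k) * dens (gd_pow (GDens (ennreal p) g) k) x)"
      using p by (simp add: C_def ennreal_power ennreal_mult'[symmetric] mult.assoc[symmetric])
    also have "\<dots> \<le> ennreal (C k) * H x"
      unfolding H_def by (intro mult_left_mono dens_gd_pow_mono that) simp
    finally show ?thesis .
  qed
  have g_le: "g x \<le> ennreal (C 1) * H x" for x
    using pow_le[of 1 x] n by (simp add: gd_conv_def gd_delta_def)
  have g_tail: "tail_le H g (C 1)"
    unfolding tail_le_def
  proof safe
    fix c assume "C 1 < c"
    then have "ennreal (C 1) * H x \<le> ennreal c * H x" for x by (intro mult_right_mono ennreal_leI) auto
    then show "eventually (\<lambda>x. g x \<le> ennreal c * H x) at_top"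
      using g_le order_trans by (blast intro: always_eventually)
  qed
  obtain a where a: "a \<ge> 0" "tail_le H g a" "\<And>c. c \<ge> 0 \<Longrightarrow> tail_le H g c \<Longrightarrow> a \<le> c"
    using tail_le_optimal[OF g_tail C] by metis
  obtain b where b: "b \<ge> 0" "tail_ge H g b" "\<And>c. tail_ge H g c \<Longrightarrow> c \<le> b"
    using tail_ge_optimal[OF g_tail C] by metis
  obtain r where r: "\<And>x. H x = ennreal (n * P) * g x + r x"
      "tail_le H r (n * (1 - P) * a)" "tail_ge H r (n * (1 - P) * b)"
    using gd_pow_tail_decomposition[OF meas mass _ _ g_le C pow_le C a(2,1) b(2,1), where n=n and k=n] p
    by (auto simp: H_def P_def)
  have r': "H x = r x + ennreal (n * P) * g x" for x using r(1)[of x] by (simp add: add.commute)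
  have scale: "ennreal (1 / (n * P)) * (ennreal (n * P) * t) = t" for t
    using P n0 by (simp add: ennreal_mult'[symmetric] mult.assoc[symmetric])
  \<comment> \<open>This makes the first constant below nonnegative, so that minimality of \<open>a\<close> applies to it.\<close>
  have "tail_le H r 1" unfolding tail_le_def
  proof safe
    fix c :: real assume "c > 1"
    have "r x \<le> ennreal c * H x" for x
    proof -
      have "r x \<le> ennreal 1 * H x" using r(1)[of x] by (simp add: add_increasing)
      also have "\<dots> \<le> ennreal c * H x" using \<open>c > 1\<close> by (intro mult_right_mono ennreal_leI) auto
      finally show ?thesis .
    qed
    then show "eventually (\<lambda>x. r x \<le> ennreal c * H x) at_top" by (simp add: always_eventually)
  qed
  then have b1: "n * (1 - P) * b \<le> 1" using tail_ge_le_tail_le[OF r(3)] by simp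
  have "tail_le H (\<lambda>x. ennreal (n * P) * g x) (1 - n * (1 - P) * b)"
    by (rule tail_le_diff[OF fin_pos tail_le_refl r(3) r'])
  from tail_le_cmult[OF this, of "1 / (n * P)"] have "tail_le H g (1 / (n * P) * (1 - n * (1 - P) * b))"
    using P by (simp only: scale) simp
  then have "a \<le> 1 / (n * P) * (1 - n * (1 - P) * b)"
    using b1 P by (intro a(3)) auto
  then have upper: "n * P * a + n * (1 - P) * b \<le> 1" using P(3) by (simp add: field_simps)
  have "tail_ge H (\<lambda>x. ennreal (n * P) * g x) (1 - n * (1 - P) * a)"
    using a P by (intro tail_ge_diff[OF fin_pos tail_ge_refl r(2) _ r']) auto
  from tail_ge_cmult[OF this, of "1 / (n * P)"] have "tail_ge H g (1 / (n * P) * (1 - n * (1 - P) * a))"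
    using P by (simp only: scale) simp
  then have "1 / (n * P) * (1 - n * (1 - P) * a) \<le> b" by (rule b(3))
  then have lower: "1 \<le> n * P * b + n * (1 - P) * a" using P(3) by (simp add: field_simps)
  have ba: "b \<le> a" using tail_ge_le_tail_le[OF b(2) a(2,1)] .
  have "n * ((2 * P - 1) * (a - b)) \<le> 0" using upper lower by (simp add: algebra_simps)
  then have "a \<le> b" using n0 P(1) by (simp add: mult_le_0_iff)
  then have ab: "a = b" using ba by simp
  then have "n * a = 1" using upper lower by (simp add: algebra_simps)
  then have an: "a > 0" using n0 by (metis a(1) less_eq_real_def mult_zero_right zero_neq_one)
  have ge: "tail_ge H g a" using b ab by simp
  note le = a(2)
  show ?thesis
    unfolding subexponential_def long_tailed_def
  proof (intro conjI allI impI)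
    have "eventually (\<lambda>x. ennreal (a / 2) * H x \<le> g x) at_top" using ge an by (simp add: tail_ge_def)
    with fin_pos[unfolded eventually_finite_pos_def] have "eventually (\<lambda>x. g x > 0) at_top"
    proof eventually_elim
      case (elim x)
      have "0 < ennreal (a / 2) * H x" using elim an by (simp add: ennreal_zero_less_mult_iff)
      then show ?case using elim by (auto intro: order.strict_trans2)
    qed
    then obtain N where "\<And>x. x \<ge> N \<Longrightarrow> g x > 0" by (auto simp: eventually_at_top_linorder)
    then show "\<exists>x0>0. \<forall>x\<ge>x0. dens (GDens (ennreal p) g) x > 0" by (intro exI[of _ "max 1 N"]) auto
  next
    fix y :: real
    have "tail_equiv (\<lambda>x. g (x - (- y))) g"
      using tail_le_shift[OF le a(1), of "- y"] tail_ge_shift[OF ge, of "- y"] le ge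
      by (intro tail_equivI[OF fin_pos an])
    then show "tail_equiv (\<lambda>x. dens (GDens (ennreal p) g) (x + y)) (dens (GDens (ennreal p) g))" by simp
  next
    let ?f2 = "\<lambda>x. ennreal (2 * p) * g x + (\<integral>\<^sup>+y. g (x - y) * g y \<partial>lborel)"
    have sq: "2 * p * a + (a * (1 - p) + a * (1 - p)) = 2 * a" by (simp add: algebra_simps)
    have "tail_le H ?f2 (2 * p * a + (a * (1 - p) + a * (1 - p)))"
      using p a(1) mass le g_le C[of 1]
      by (intro tail_le_add tail_le_cmult tail_le_convolution[where C="C 1" and D="C 1"]) auto
    moreover have "tail_ge H ?f2 (2 * p * a + (a * (1 - p) + a * (1 - p)))"
      using p a(1) mass ge by (intro tail_ge_add tail_ge_cmult tail_ge_convolution) auto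
    moreover have "tail_le H (\<lambda>x. ennreal 2 * g x) (2 * a)" "tail_ge H (\<lambda>x. ennreal 2 * g x) (2 * a)"
      using le ge by (intro tail_le_cmult tail_ge_cmult; simp)+
    ultimately have "tail_equiv ?f2 (\<lambda>x. ennreal 2 * g x)"
      unfolding sq using an by (intro tail_equivI[OF fin_pos, of "2 * a"]) auto
    moreover have "dens (gd_pow (GDens (ennreal p) g) 2) = ?f2"
      using p by (auto simp: dens_gd_pow_2 ennreal_mult mult.assoc)
    ultimately show "tail_equiv (dens (gd_pow (GDens (ennreal p) g) 2)) (\<lambda>x. 2 * dens (GDens (ennreal p) g) x)"
      by simp
  qed
qed

theorem proposition4p4:
  fixes n :: nat and p :: real and f :: "real \<Rightarrow> real"
  assumes "n \<ge> 2"
    and "prob_density f"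
    and "p \<in> {2 powr (- 1 / (real n - 1)) <..< 1}"
    and "subexponential (gd_pow (gd_mix p f) n)"
  shows "subexponential (gd_mix p f)"
proof -
  have p_gt: "p > 2 powr (- 1 / (real n - 1))" and p1: "p < 1" using assms(3) by auto
  have p0: "p > 0" using p_gt by (rule order.strict_trans[rotated]) simp
  have "1 / 2 = (2 powr (- 1 / (real n - 1)) :: real) ^ (n - 1)"
    using assms(1) by (subst powr_power) (auto simp: of_nat_diff powr_minus_divide)
  also have "\<dots> < p ^ (n - 1)" using p_gt assms(1) by (intro power_strict_mono) auto
  finally have large: "p ^ (n - 1) > 1 / 2" .
  have f[measurable]: "f \<in> borel_measurable borel" "\<And>x. f x \<ge> 0" "(\<integral>\<^sup>+x. ennreal (f x) \<partial>lborel) = 1"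
    using assms(2) by (auto simp: prob_density_def)
  have "(\<integral>\<^sup>+x. ennreal ((1 - p) * f x) \<partial>lborel) = ennreal (1 - p)"
    using p1 f by (simp add: ennreal_mult nn_integral_cmult)
  then show ?thesis
    using assms(1,4) p0 p1 large unfolding gd_mix_def
    by (intro subexponential_convolution_root[where n=n]) auto
qed

end
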